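(* Let $S=K[x_1,\dots,x_n]$ be a polynomial ring over a field $K$ and let $I\subset S$ be a linearly related monomial ideal generated in degree $d$. Then $\mathrm{HS}_1(I)$ is also linearly related.
   Context: For $\mathbf a=(a_1,\dots,a_n)\in\mathbb Z_{\ge0}^n$ write $\mathbf x^{\mathbf a}=x_1^{a_1}\cdots x_n^{a_n}$. For a monomial ideal $J\subset S$, the $i$th homological shift ideal of $J$ is the monomial ideal $$\mathrm{HS}_i(J)=(\mathbf x^{\mathbf a}\ :\ \mathrm{Tor}^S_i(K,J)_{\mathbf a}\neq 0),$$ where $\mathrm{Tor}^S_i(K,J)$ carries its natural $\mathbb Z^n$-grading and $K=S/(x_1,\dots,x_n)$. A graded ideal $J$ generated in a single degree $d$ is linearly related (has linear relations) if its first syzygy module is generated by linear relations, i.e. $\mathrm{Tor}^S_1(K,J)_j=0$ for all $j\ne d+1$. The zero ideal is regarded as linearly related. *)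

theory Defs
  imports Complex_Main "HOL-Library.Poly_Mapping"
begin

section \<open>Polynomials, ideals and gradings\<close>

text \<open>
  Exponent vectors are finitely supported functions from the index type of the variables to
  \<open>nat\<close>; a polynomial maps exponent vectors to coefficients.  The variables are indexed by a type
  of sort \<open>{finite, linorder}\<close>, i.e. \<open>x\<^sub>1 < \<dots> < x\<^sub>n\<close> with \<open>n\<close> the cardinality of the type.
  The multiplication of \<open>Poly_Mapping\<close> is the convolution product, so the ring \<open>S\<close> is
  the whole type.
\<close>

abbreviation lookup :: "('a \<Rightarrow>\<^sub>0 'b::zero) \<Rightarrow> 'a \<Rightarrow> 'b" where
  "lookup \<equiv> Poly_Mapping.lookup"
abbreviation keys :: "('a \<Rightarrow>\<^sub>0 'b::zero) \<Rightarrow> 'a set" where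
  "keys \<equiv> Poly_Mapping.keys"

type_synonym 'n expo = "'n \<Rightarrow>\<^sub>0 nat"
type_synonym ('n, 'k) mpoly = "('n \<Rightarrow>\<^sub>0 nat) \<Rightarrow>\<^sub>0 'k"

abbreviation monom :: "'n expo \<Rightarrow> ('n, 'k::zero_neq_one) mpoly" where
  "monom a \<equiv> Poly_Mapping.single a 1"

definition var :: "'n \<Rightarrow> ('n, 'k::zero_neq_one) mpoly" where
  "var v = monom (Poly_Mapping.single v 1)"

definition total_degree :: "'n::finite expo \<Rightarrow> nat" where
  "total_degree a = (\<Sum>v\<in>UNIV. lookup a v)"

definition homogeneous :: "nat \<Rightarrow> ('n::finite, 'k::zero) mpoly \<Rightarrow> bool" where
  "homogeneous d f \<longleftrightarrow> (\<forall>m\<in>keys f. total_degree m = d)"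

text \<open>The ideals of a commutative ring are its submodules as a module over itself.
  A global interpretation of the locale is avoided, because its simplification rule for iterated scaling
  would reassociate every product and loop together with \<open>algebra_simps\<close>.\<close>

lemma module_times: "module ((*) :: 'a::comm_ring_1 \<Rightarrow> 'a \<Rightarrow> 'a)"
  by standard (simp_all add: algebra_simps)

definition ideal_span :: "'a::comm_ring_1 set \<Rightarrow> 'a set" where
  "ideal_span A = module.span (*) A"

definition monomial_ideal :: "('n, 'k::field) mpoly set \<Rightarrow> bool" where
  "monomial_ideal J \<longleftrightarrow> (\<exists>A. J = ideal_span (monom ` A))"

definition generated_in_degree :: "nat \<Rightarrow> ('n::finite, 'k::field) mpoly set \<Rightarrow> bool" where
  "generated_in_degree d J \<longleftrightarrow> (\<exists>G. (\<forall>g\<in>G. homogeneous d g) \<and> J = ideal_span G)"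

definition irrelevant_ideal :: "('n, 'k::field) mpoly set" where
  "irrelevant_ideal = ideal_span (range var)"


section \<open>Complexes of multigraded free modules\<close>

text \<open>
  The free module on a basis \<open>B\<close> consists of the finitely supported functions \<open>B \<rightarrow> S\<close>.
  A basis element \<open>b\<close> sits in multidegree \<open>bdeg P b\<close> and is sent to \<open>bdry P b\<close> by the differential.
\<close>

record (overloaded) ('n, 'k::zero, 'b) free_complex =
  basis :: "nat \<Rightarrow> 'b set"
  bdeg :: "'b \<Rightarrow> 'n expo"
  bdry :: "'b \<Rightarrow> 'b \<Rightarrow>\<^sub>0 ('n, 'k) mpoly"

definition smult :: "'r \<Rightarrow> ('b \<Rightarrow>\<^sub>0 'r) \<Rightarrow> ('b \<Rightarrow>\<^sub>0 'r::comm_ring_1)" where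
  "smult r c = Poly_Mapping.map ((*) r) c"

definition differential ::
  "('n, 'k::field, 'b) free_complex \<Rightarrow> ('b \<Rightarrow>\<^sub>0 ('n, 'k) mpoly) \<Rightarrow> ('b \<Rightarrow>\<^sub>0 ('n, 'k) mpoly)" where
  "differential P c = (\<Sum>b\<in>keys c. smult (lookup c b) (bdry P b))"

text \<open>
  Since \<open>P\<^sub>i\<close> is free on \<open>basis P i\<close>, the module \<open>P\<^sub>i \<otimes>\<^sub>S J\<close> is the direct sum of copies of \<open>J\<close> indexed by
  \<open>basis P i\<close>, that is, the submodule \<open>J P\<^sub>i\<close> of \<open>P\<^sub>i\<close>; the differential of \<open>P \<otimes>\<^sub>S J\<close> is the
  restriction of that of \<open>P\<close>.  For \<open>J = UNIV\<close> one gets \<open>P\<close> itself.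
\<close>

definition tensor_chains ::
  "('n, 'k::field, 'b) free_complex \<Rightarrow> ('n, 'k) mpoly set \<Rightarrow> nat \<Rightarrow> ('b \<Rightarrow>\<^sub>0 ('n, 'k) mpoly) set" where
  "tensor_chains P J i = {c. keys c \<subseteq> basis P i \<and> (\<forall>b. lookup c b \<in> J)}"

definition cycles ::
  "('n, 'k::field, 'b) free_complex \<Rightarrow> ('n, 'k) mpoly set \<Rightarrow> nat \<Rightarrow> ('b \<Rightarrow>\<^sub>0 ('n, 'k) mpoly) set" where
  "cycles P J i = {c \<in> tensor_chains P J i. differential P c = 0}"

definition boundaries ::
  "('n, 'k::field, 'b) free_complex \<Rightarrow> ('n, 'k) mpoly set \<Rightarrow> nat \<Rightarrow> ('b \<Rightarrow>\<^sub>0 ('n, 'k) mpoly) set" where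
  "boundaries P J i = differential P ` tensor_chains P J (Suc i)"

definition multihomogeneous ::
  "('n, 'k::field, 'b) free_complex \<Rightarrow> 'n expo \<Rightarrow> ('b \<Rightarrow>\<^sub>0 ('n, 'k) mpoly) \<Rightarrow> bool" where
  "multihomogeneous P a c \<longleftrightarrow> (\<forall>b. \<forall>m\<in>keys (lookup c b). m + bdeg P b = a)"

definition total_homogeneous ::
  "('n::finite, 'k::field, 'b) free_complex \<Rightarrow> nat \<Rightarrow> ('b \<Rightarrow>\<^sub>0 ('n, 'k) mpoly) \<Rightarrow> bool" where
  "total_homogeneous P j c \<longleftrightarrow> (\<forall>b. \<forall>m\<in>keys (lookup c b). total_degree (m + bdeg P b) = j)"

text \<open>\<open>P\<close> is a multigraded free resolution of \<open>K = S/(x\<^sub>1,\<dots>,x\<^sub>n)\<close>.  The augmentation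
  \<open>P\<^sub>0 \<rightarrow> K\<close> sends a basis element \<open>b\<close> to the class of \<open>\<epsilon> b\<close>.\<close>

definition resolves_residue_field :: "('n, 'k::field, 'b) free_complex \<Rightarrow> bool" where
  "resolves_residue_field P \<longleftrightarrow>
     (\<forall>b\<in>basis P 0. bdry P b = 0) \<and>
     (\<forall>i. \<forall>b\<in>basis P (Suc i). keys (bdry P b) \<subseteq> basis P i) \<and>
     (\<forall>i. \<forall>b\<in>basis P i. multihomogeneous P (bdeg P b) (bdry P b)) \<and>
     (\<forall>i>0. cycles P UNIV i = boundaries P UNIV i) \<and>
     (\<exists>\<epsilon>. (\<forall>b\<in>basis P 0. \<forall>m\<in>keys (\<epsilon> b). m = bdeg P b) \<and>
        (let aug = (\<lambda>c. \<Sum>b\<in>keys c. lookup c b * \<epsilon> b) in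
          (\<exists>c\<in>tensor_chains P UNIV 0. aug c - 1 \<in> irrelevant_ideal) \<and>
          {c \<in> tensor_chains P UNIV 0. aug c \<in> irrelevant_ideal} = boundaries P UNIV 0))"


section \<open>The Koszul resolution of the residue field\<close>

definition koszul :: "('n::{finite,linorder}, 'k::field, 'n set) free_complex" where
  "koszul =
     \<lparr> basis = (\<lambda>i. {F. card F = i}),
       bdeg = (\<lambda>F. \<Sum>v\<in>F. Poly_Mapping.single v 1),
       bdry = (\<lambda>F. \<Sum>v\<in>F. Poly_Mapping.single (F - {v}) ((-1) ^ card {w\<in>F. w < v} * var v)) \<rparr>"

lemma lookup_smult [simp]: "lookup (smult r c) b = r * lookup c b"
  by (auto simp: smult_def map.rep_eq when_def)

lemma smult_add_left: "smult (r + s) c = smult r c + smult s c"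
  by (intro poly_mapping_eqI) (simp add: lookup_add algebra_simps)

lemma smult_add_right: "smult r (c + c') = smult r c + smult r c'"
  by (intro poly_mapping_eqI) (simp add: lookup_add algebra_simps)

lemma smult_0_left [simp]: "smult 0 c = 0"
  by (intro poly_mapping_eqI) simp

lemma smult_0_right [simp]: "smult r 0 = 0"
  by (intro poly_mapping_eqI) simp

lemma smult_smult: "smult r (smult s c) = smult (r * s) c"
  by (intro poly_mapping_eqI) (simp add: algebra_simps)

lemma smult_single [simp]: "smult r (Poly_Mapping.single b s) = Poly_Mapping.single b (r * s)"
  by (intro poly_mapping_eqI) (simp add: lookup_single when_def)

lemma smult_sum_right: "smult r (sum f A) = (\<Sum>x\<in>A. smult r (f x))"
  by (induction A rule: infinite_finite_induct) (simp_all add: smult_add_right)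

lemma differential_0 [simp]: "differential P 0 = 0"
  by (simp add: differential_def)

lemma differential_add: "differential P (c + c') = differential P c + differential P c'"
  unfolding differential_def by (rule setsum_keys_plus_distrib) (simp_all add: smult_add_left)

lemma differential_sum: "differential P (sum f A) = (\<Sum>x\<in>A. differential P (f x))"
  by (induction A rule: infinite_finite_induct) (simp_all add: differential_add)

lemma differential_single [simp]:
  "differential P (Poly_Mapping.single b r) = smult r (bdry P b)"
  by (cases "r = 0") (simp_all add: differential_def)

lemmas ideal_span_zero = module.span_zero[OF module_times, folded ideal_span_def]
  and ideal_span_add = module.span_add[OF module_times, folded ideal_span_def]
  and ideal_span_scale = module.span_scale[OF module_times, folded ideal_span_def]
  and ideal_span_base = module.span_base[OF module_times, folded ideal_span_def]
  and ideal_span_induct_alt [consumes 1, case_names base step, induct set: ideal_span] =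
    module.span_induct_alt[OF module_times, folded ideal_span_def]

lemma sum_single_keys: "(\<Sum>k\<in>keys p. Poly_Mapping.single k (lookup p k)) = p"
  by (intro poly_mapping_eqI)
    (simp add: lookup_sum lookup_single when_def sum.delta in_keys_iff)

lemma chain_induct [consumes 1, case_names zero add single]:
  fixes c :: "'b \<Rightarrow>\<^sub>0 ('m \<Rightarrow>\<^sub>0 'k::comm_monoid_add)"
  assumes "keys c \<subseteq> A" "P 0" "\<And>c c'. P c \<Longrightarrow> P c' \<Longrightarrow> P (c + c')"
    and gen: "\<And>b m k. b \<in> A \<Longrightarrow> P (Poly_Mapping.single b (Poly_Mapping.single m k))"
  shows "P c"
proof -
  have sum_P: "P (sum f X)" if "\<And>x. x \<in> X \<Longrightarrow> P (f x)" for f :: "'z \<Rightarrow> 'b \<Rightarrow>\<^sub>0 ('m \<Rightarrow>\<^sub>0 'k)" and X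
    using that by (induction X rule: infinite_finite_induct) (auto intro: assms)
  have "P (Poly_Mapping.single b p)" if "b \<in> A" for b p
  proof -
    have "Poly_Mapping.single b (sum f X) = (\<Sum>x\<in>X. Poly_Mapping.single b (f x))"
      for f :: "'m \<Rightarrow> ('m \<Rightarrow>\<^sub>0 'k)" and X
      by (induction X rule: infinite_finite_induct) (simp_all add: single_add)
    then have "Poly_Mapping.single b p =
        (\<Sum>m\<in>keys p. Poly_Mapping.single b (Poly_Mapping.single m (lookup p m)))"
      by (metis sum_single_keys)
    with that show ?thesis
      by (simp add: sum_P gen)
  qed
  with assms(1) have "P (\<Sum>b\<in>keys c. Poly_Mapping.single b (lookup c b))"
    by (intro sum_P) blast
  then show ?thesis
    by (simp add: sum_single_keys)
qed

lemma koszul_simps [simp]: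
  "basis koszul i = {F. card F = i}"
  "bdeg koszul F = (\<Sum>v\<in>F. Poly_Mapping.single v 1)"
  "bdry koszul F =
     (\<Sum>v\<in>F. Poly_Mapping.single (F - {v}) ((-1) ^ card {w\<in>F. w < v} * var v))"
  by (simp_all add: koszul_def)

lemma differential_koszul_single:
  "differential koszul (Poly_Mapping.single F r) =
     (\<Sum>v\<in>F. Poly_Mapping.single (F - {v}) (r * ((-1) ^ card {w\<in>F. w < v} * var v)))"
  by (simp add: smult_sum_right)

lemma keys_koszul_bdry:
  assumes "card F = Suc i"
  shows "keys (bdry koszul F :: 'n::{finite,linorder} set \<Rightarrow>\<^sub>0 ('n, 'k::field) mpoly) \<subseteq> {G. card G = i}"
proof -
  have "keys (bdry koszul F :: 'n set \<Rightarrow>\<^sub>0 ('n, 'k) mpoly) \<subseteq>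
      (\<Union>v\<in>F. keys (Poly_Mapping.single (F - {v}) ((-1) ^ card {w\<in>F. w < v} * var v :: ('n, 'k) mpoly)))"
    unfolding koszul_simps by (rule keys_sum)
  also have "\<dots> \<subseteq> (\<lambda>v. F - {v}) ` F"
    by (auto split: if_splits)
  finally show ?thesis
    using assms by (auto simp: card_Diff_singleton)
qed

lemma keys_differential_koszul:
  fixes c :: "'n::{finite,linorder} set \<Rightarrow>\<^sub>0 ('n, 'k::field) mpoly"
  assumes "keys c \<subseteq> {F. card F = Suc i}"
  shows "keys (differential koszul c) \<subseteq> {F. card F = i}"
proof -
  have "keys (differential koszul c) \<subseteq>
      (\<Union>b\<in>keys c. keys (smult (lookup c b) (bdry koszul b)))"
    unfolding differential_def by (rule keys_sum)
  also have "\<dots> \<subseteq> (\<Union>b\<in>keys c. keys (bdry koszul b :: 'n set \<Rightarrow>\<^sub>0 ('n, 'k) mpoly))"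
  proof (intro UN_mono subset_refl subsetI)
    fix b x assume "x \<in> keys (smult (lookup c b) (bdry koszul b))"
    then have "lookup c b * lookup (bdry koszul b :: 'n set \<Rightarrow>\<^sub>0 ('n, 'k) mpoly) x \<noteq> 0"
      unfolding in_keys_iff lookup_smult .
    then show "x \<in> keys (bdry koszul b :: 'n set \<Rightarrow>\<^sub>0 ('n, 'k) mpoly)"
      unfolding in_keys_iff by fastforce
  qed
  also have "\<dots> \<subseteq> {F. card F = i}"
    using assms keys_koszul_bdry by (intro UN_least) blast
  finally show ?thesis .
qed

lemma differential_koszul_square:
  fixes c :: "'n::{finite,linorder} set \<Rightarrow>\<^sub>0 ('n, 'k::field) mpoly"
  shows "differential koszul (differential koszul c) = 0"
proof -
  have "keys c \<subseteq> UNIV" by simp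
  then show ?thesis
  proof (induction rule: chain_induct)
    case zero show ?case by simp
  next
    case (add c c') then show ?case by (simp add: differential_add)
  next
    case (single F m k)
    define r :: "('n, 'k) mpoly" where "r = Poly_Mapping.single m k"
    define s :: "'n set \<Rightarrow> 'n \<Rightarrow> ('n, 'k) mpoly" where "s F v = (-1) ^ card {w\<in>F. w < v}" for F v
    define T where "T v w = Poly_Mapping.single (F - {v} - {w})
        (r * (s F v * var v) * (s (F - {v}) w * var w))" for v w
    have anti: "T v w + T w v = 0" if "v \<in> F" "w \<in> F" "v < w" for v w
    proof -
      have 1: "{u \<in> F. u < w} = insert v {u \<in> F - {v}. u < w}" using that by auto
      have 2: "{u \<in> F - {w}. u < v} = {u \<in> F. u < v}" using that by auto
      have "s F w = - s (F - {v}) w" by (simp add: s_def 1)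
      moreover have "s (F - {w}) v = s F v" unfolding s_def 2 ..
      ultimately have "r * (s F v * var v) * (s (F - {v}) w * var w) +
          r * (s F w * var w) * (s (F - {w}) v * var v) = 0"
        by (simp add: algebra_simps)
      moreover have "F - {w} - {v} = F - {v} - {w}" by auto
      ultimately show ?thesis
        unfolding T_def by (metis single_add single_zero)
    qed
    have "differential koszul (differential koszul (Poly_Mapping.single F r)) =
        (\<Sum>v\<in>F. \<Sum>w\<in>F - {v}. T v w)"
      by (simp add: differential_koszul_single differential_sum T_def s_def del: differential_single)
    also have "\<dots> = (\<Sum>(v,w)\<in>(SIGMA v:F. F - {v}). T v w)"
      by (simp add: sum.Sigma)
    also have "(SIGMA v:F. F - {v}) = {(v,w). v \<in> F \<and> w \<in> F \<and> v < w} \<union> {(v,w). v \<in> F \<and> w \<in> F \<and> w < v}"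
      by auto
    also have "(\<Sum>(v,w)\<in>\<dots>. T v w) = (\<Sum>(v,w)\<in>{(v,w). v \<in> F \<and> w \<in> F \<and> v < w}. T v w) +
        (\<Sum>(v,w)\<in>{(v,w). v \<in> F \<and> w \<in> F \<and> w < v}. T v w)"
      by (rule sum.union_disjoint) auto
    also have "(\<Sum>(v,w)\<in>{(v,w). v \<in> F \<and> w \<in> F \<and> w < v}. T v w) =
        (\<Sum>(v,w)\<in>{(v,w). v \<in> F \<and> w \<in> F \<and> v < w}. T w v)"
      by (rule sum.reindex_bij_witness[of _ prod.swap prod.swap]) auto
    also have "(\<Sum>(v,w)\<in>{(v,w). v \<in> F \<and> w \<in> F \<and> v < w}. T v w) + \<dots> = 0"
      unfolding sum.distrib[symmetric] by (rule sum.neutral) (auto simp: anti)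
    finally show ?case by (simp add: r_def)
  qed
qed

text \<open>A contracting homotopy, defined one multidegree \<open>a \<noteq> 0\<close> at a time by means of the
  smallest variable in the support of \<open>a\<close>.\<close>

definition lead :: "'n::{finite,linorder} set \<Rightarrow> 'n expo \<Rightarrow> 'n" where
  "lead F m = Min (keys (m + (\<Sum>v\<in>F. Poly_Mapping.single v 1)))"

definition homotopy_gen ::
  "'n::{finite,linorder} set \<Rightarrow> 'n expo \<Rightarrow> 'k::field \<Rightarrow> 'n set \<Rightarrow>\<^sub>0 ('n, 'k) mpoly" where
  "homotopy_gen F m k =
     (let v = lead F m in
       if v \<in> F then 0
       else Poly_Mapping.single (insert v F) (Poly_Mapping.single (m - Poly_Mapping.single v 1) k))"

definition homotopy ::
  "('n::{finite,linorder} set \<Rightarrow>\<^sub>0 ('n, 'k::field) mpoly) \<Rightarrow> 'n set \<Rightarrow>\<^sub>0 ('n, 'k) mpoly" where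
  "homotopy c = (\<Sum>F\<in>keys c. \<Sum>m\<in>keys (lookup c F). homotopy_gen F m (lookup (lookup c F) m))"

lemma homotopy_gen_0 [simp]: "homotopy_gen F m 0 = 0"
  by (simp add: homotopy_gen_def Let_def)

lemma homotopy_gen_add: "homotopy_gen F m (k + l) = homotopy_gen F m k + homotopy_gen F m l"
  by (simp add: homotopy_gen_def Let_def single_add)

lemma homotopy_0 [simp]: "homotopy 0 = 0"
  by (simp add: homotopy_def)

lemma homotopy_add: "homotopy (c + c') = homotopy c + homotopy c'"
  unfolding homotopy_def
  by (rule setsum_keys_plus_distrib[where f = "\<lambda>F p. \<Sum>m\<in>keys p. homotopy_gen F m (lookup p m)"])
    (auto intro: setsum_keys_plus_distrib simp: homotopy_gen_add)

lemma homotopy_sum: "homotopy (sum f A) = (\<Sum>x\<in>A. homotopy (f x))"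
  by (induction A rule: infinite_finite_induct) (simp_all add: homotopy_add)

lemma single_eq_0_iff: "Poly_Mapping.single m k = 0 \<longleftrightarrow> k = 0"
  by (metis lookup_single_eq lookup_zero single_zero)

lemma homotopy_single:
  "homotopy (Poly_Mapping.single F (Poly_Mapping.single m k)) = homotopy_gen F m k"
  by (cases "k = 0") (simp_all add: homotopy_def single_eq_0_iff)

lemma lookup_bdeg: "lookup (\<Sum>v\<in>F. Poly_Mapping.single v (1::nat)) w = (if w \<in> F then 1 else 0)"
  for F :: "'n::finite set"
  by (simp add: lookup_sum lookup_single when_def)

lemma lead_cong:
  assumes "m + (\<Sum>v\<in>F. Poly_Mapping.single v 1) = m' + (\<Sum>v\<in>F'. Poly_Mapping.single v 1)"
  shows "lead F m = lead F' m'"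
  using assms by (simp add: lead_def)

lemma neg1_power_times_single_var:
  "Poly_Mapping.single m k * ((-1) ^ j * var v) =
     (Poly_Mapping.single (m + Poly_Mapping.single v 1) ((-1) ^ j * k) :: ('n, 'k::field) mpoly)"
  by (induction j) (simp_all add: var_def mult_single single_uminus[symmetric])

lemma homotopy_gen_identity:
  fixes F :: "'n::{finite,linorder} set" and k :: "'k::field"
  assumes ne: "F \<noteq> {} \<or> m \<noteq> 0"
  defines "x \<equiv> Poly_Mapping.single F (Poly_Mapping.single m k)"
  shows "differential koszul (homotopy x) + homotopy (differential koszul x) = x"
proof -
  define a where "a = m + (\<Sum>v\<in>F. Poly_Mapping.single v (1::nat))"
  define u where "u = lead F m"
  have la: "lookup a w = lookup m w + (if w \<in> F then 1 else 0)" for w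
    by (simp add: a_def lookup_add lookup_bdeg del: One_nat_def)
  have "keys a \<noteq> {}"
  proof -
    from ne obtain w where "w \<in> F \<or> lookup m w \<noteq> 0"
      by (metis ex_in_conv poly_mapping_eqI lookup_zero)
    then have "lookup a w \<noteq> 0" by (auto simp: la)
    then show ?thesis by (auto simp: in_keys_iff)
  qed
  moreover have u: "u = Min (keys a)" by (simp add: u_def lead_def a_def)
  ultimately have ua: "u \<in> keys a" and umin: "\<And>w. w \<in> keys a \<Longrightarrow> u \<le> w" by auto
  have uF: "u \<le> w" if "w \<in> F" for w
    using that by (intro umin) (simp add: in_keys_iff la)
  define sg :: "'n set \<Rightarrow> 'n \<Rightarrow> 'k" where "sg G v = (-1) ^ card {w\<in>G. w < v}" for G v
  define X :: "'n \<Rightarrow> 'n expo" where "X v = Poly_Mapping.single v 1" for v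
  have d: "differential koszul (Poly_Mapping.single G (Poly_Mapping.single m' k')) =
      (\<Sum>v\<in>G. Poly_Mapping.single (G - {v}) (Poly_Mapping.single (m' + X v) (sg G v * k')))"
    for G m' and k' :: 'k
    unfolding differential_koszul_single neg1_power_times_single_var by (simp add: sg_def X_def)
  have leadw: "lead (F - {w}) (m + X w) = u" if "w \<in> F" for w
    unfolding u_def
  proof (rule lead_cong)
    have "(\<Sum>v\<in>F. Poly_Mapping.single v 1) = X w + (\<Sum>v\<in>F - {w}. Poly_Mapping.single v (1::nat))"
      unfolding X_def using that by (intro sum.remove) auto
    then show "m + X w + (\<Sum>v\<in>F - {w}. Poly_Mapping.single v 1) = m + (\<Sum>v\<in>F. Poly_Mapping.single v 1)"
      by (simp add: add.assoc)
  qed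
  have hd: "homotopy (differential koszul x) =
      (\<Sum>w\<in>F. homotopy_gen (F - {w}) (m + X w) (sg F w * k))"
    unfolding x_def d homotopy_sum homotopy_single ..
  show ?thesis
  proof (cases "u \<in> F")
    case True
    have empty: "{w\<in>F. w < u} = {}" using uF by fastforce
    have sgu: "sg F u = 1" unfolding sg_def empty by simp
    have "homotopy_gen (F - {w}) (m + X w) (sg F w * k) = (if w = u then x else 0)" if "w \<in> F" for w
    proof (cases "w = u")
      case True
      with leadw[of u] \<open>u \<in> F\<close> have "lead (F - {w}) (m + X w) = u" by simp
      with True \<open>u \<in> F\<close> show ?thesis
        by (simp add: homotopy_gen_def sgu Let_def insert_absorb x_def X_def[symmetric] del: One_nat_def)
    next
      case False
      with that \<open>u \<in> F\<close> show ?thesis by (simp add: homotopy_gen_def leadw Let_def)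
    qed
    then have "homotopy (differential koszul x) = x"
      unfolding hd using True by simp
    moreover have "homotopy x = 0"
      using True by (simp add: x_def homotopy_single homotopy_gen_def u_def[symmetric] Let_def)
    ultimately show ?thesis by simp
  next
    case False
    have mu: "lookup m u \<noteq> 0" using ua False by (auto simp: in_keys_iff la)
    have mX: "m - X u + X u = m"
      using mu by (intro poly_mapping_eqI) (auto simp: X_def lookup_add lookup_minus lookup_single when_def)
    have hx: "homotopy x = Poly_Mapping.single (insert u F) (Poly_Mapping.single (m - X u) k)"
      using False by (simp add: x_def homotopy_single homotopy_gen_def u_def[symmetric] Let_def X_def)
    have ult: "u < w" if "w \<in> F" for w using uF[OF that] that False by (metis order_le_less)
    have empty: "{w \<in> insert u F. w < u} = {}" using uF by fastforce
    have sgu: "sg (insert u F) u = 1" unfolding sg_def empty by simp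
    have sgw: "sg (insert u F) w = - sg F w" if "w \<in> F" for w
    proof -
      have "{v \<in> insert u F. v < w} = insert u {v \<in> F. v < w}" using ult[OF that] by auto
      then show ?thesis using False by (simp add: sg_def)
    qed
    have "differential koszul (homotopy x) = x +
        (\<Sum>w\<in>F. Poly_Mapping.single (insert u F - {w}) (Poly_Mapping.single (m - X u + X w) (sg (insert u F) w * k)))"
      unfolding hx d using False by (simp add: sgu mX x_def)
    also have "(\<Sum>w\<in>F. Poly_Mapping.single (insert u F - {w}) (Poly_Mapping.single (m - X u + X w) (sg (insert u F) w * k)))
        = (\<Sum>w\<in>F. - homotopy_gen (F - {w}) (m + X w) (sg F w * k))"
    proof (rule sum.cong[OF refl])
      fix w assume w: "w \<in> F"
      have e: "insert u F - {w} = insert u (F - {w})" using w False by auto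
      have f: "m - X u + X w = m + X w - X u"
        using mu by (intro poly_mapping_eqI) (auto simp: X_def lookup_add lookup_minus lookup_single when_def)
      show "Poly_Mapping.single (insert u F - {w}) (Poly_Mapping.single (m - X u + X w) (sg (insert u F) w * k))
          = - homotopy_gen (F - {w}) (m + X w) (sg F w * k)"
        using False w by (simp add: homotopy_gen_def leadw Let_def e f sgw X_def[symmetric] single_uminus[symmetric]
          del: One_nat_def)
    qed
    finally show ?thesis
      unfolding hd by (simp add: sum_negf)
  qed
qed

lemma homotopy_identity:
  fixes c :: "'n::{finite,linorder} set \<Rightarrow>\<^sub>0 ('n, 'k::field) mpoly"
  assumes "keys c \<subseteq> {F. card F = Suc i}"
  shows "differential koszul (homotopy c) + homotopy (differential koszul c) = c"
  using assms
proof (induction rule: chain_induct)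
  case zero show ?case by simp
next
  case (add c c')
  then show ?case
    by (simp add: differential_add homotopy_add algebra_simps)
next
  case (single F m k)
  then show ?case by (intro homotopy_gen_identity) auto
qed

lemma keys_homotopy:
  fixes c :: "'n::{finite,linorder} set \<Rightarrow>\<^sub>0 ('n, 'k::field) mpoly"
  assumes "keys c \<subseteq> {F. card F = i}"
  shows "keys (homotopy c) \<subseteq> {F. card F = Suc i}"
  using assms
proof (induction rule: chain_induct)
  case zero show ?case by simp
next
  case (add c c')
  then show ?case
    unfolding homotopy_add using keys_add[of "homotopy c" "homotopy c'"] by blast
next
  case (single F m k)
  then show ?case by (auto simp: homotopy_single homotopy_gen_def Let_def split: if_splits)
qed

theorem koszul_resolves_residue_field:
  "resolves_residue_field (koszul :: ('n::{finite,linorder}, 'k::field, 'n set) free_complex)"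
  (is "resolves_residue_field ?P")
proof -
  have bdry0: "\<forall>b\<in>basis ?P 0. bdry ?P b = 0"
    by simp
  have bdry_keys: "\<forall>i. \<forall>b\<in>basis ?P (Suc i). keys (bdry ?P b) \<subseteq> basis ?P i"
    using keys_koszul_bdry by (metis koszul_simps(1) mem_Collect_eq)
  have hom: "multihomogeneous ?P (bdeg ?P F) (bdry ?P F)" for F
    unfolding multihomogeneous_def
  proof (intro allI ballI)
    fix G m assume m: "m \<in> keys (lookup (bdry ?P F) G)"
    have "lookup (bdry ?P F) G =
        (\<Sum>v\<in>F. lookup (Poly_Mapping.single (F - {v}) ((-1) ^ card {w\<in>F. w < v} * var v)) G)"
      by (simp add: lookup_sum)
    with m have "m \<in> keys (\<Sum>v\<in>F.
        lookup (Poly_Mapping.single (F - {v}) ((-1) ^ card {w\<in>F. w < v} * var v :: ('n, 'k) mpoly)) G)"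
      by simp
    then obtain v where v: "v \<in> F"
      and mv: "m \<in> keys (lookup (Poly_Mapping.single (F - {v}) ((-1) ^ card {w\<in>F. w < v} * var v :: ('n, 'k) mpoly)) G)"
      by (rule UN_E[OF subsetD[OF keys_sum]])
    then have G: "G = F - {v}" by (auto simp: lookup_single when_def split: if_splits)
    have "m \<in> keys (Poly_Mapping.single 0 1 * ((-1) ^ card {w\<in>F. w < v} * var v) :: ('n, 'k) mpoly)"
      using mv by (simp add: G)
    then have "m = Poly_Mapping.single v 1"
      unfolding neg1_power_times_single_var by (simp split: if_splits)
    then show "m + bdeg ?P G = bdeg ?P F"
      by (simp add: G sum.remove[OF finite v])
  qed
  have exact: "cycles ?P UNIV i = boundaries ?P UNIV i" if "i > 0" for i
  proof
    show "cycles ?P UNIV i \<subseteq> boundaries ?P UNIV i"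
    proof
      fix c assume "c \<in> cycles ?P UNIV i"
      then have c: "keys c \<subseteq> {F. card F = i}" "differential ?P c = 0"
        by (auto simp: cycles_def tensor_chains_def)
      with homotopy_identity[of c "i - 1"] that have "c = differential ?P (homotopy c)" by simp
      with keys_homotopy[OF c(1)] show "c \<in> boundaries ?P UNIV i"
        by (auto simp: boundaries_def tensor_chains_def)
    qed
    show "boundaries ?P UNIV i \<subseteq> cycles ?P UNIV i"
      using keys_differential_koszul
      by (auto simp: boundaries_def cycles_def tensor_chains_def differential_koszul_square)
  qed
  define aug where "aug = (\<lambda>c :: 'n set \<Rightarrow>\<^sub>0 ('n, 'k) mpoly. \<Sum>b\<in>keys c. lookup c b * (1 :: ('n, 'k) mpoly))"
  have aug: "aug c = lookup c {} \<and> c = Poly_Mapping.single {} (lookup c {})" if "c \<in> tensor_chains ?P UNIV 0" for c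
  proof -
    have k: "keys c \<subseteq> {{}}" using that by (auto simp: tensor_chains_def)
    have "aug c = (\<Sum>b\<in>{{}}. lookup c b)"
      unfolding aug_def mult_1_right
      by (rule sum.mono_neutral_left) (use k in \<open>auto simp: in_keys_iff\<close>)
    moreover have "c = Poly_Mapping.single {} (lookup c {})"
    proof (rule poly_mapping_eqI)
      fix b show "lookup c b = lookup (Poly_Mapping.single {} (lookup c {})) b"
        using k by (cases "b = {}") (auto simp: lookup_single simp flip: not_in_keys_iff_lookup_eq_zero)
    qed
    ultimately show ?thesis by simp
  qed
  have chains0: "Poly_Mapping.single {} f \<in> tensor_chains ?P UNIV 0" for f
    by (auto simp: tensor_chains_def split: if_splits)
  have ker: "{c \<in> tensor_chains ?P UNIV 0. aug c \<in> irrelevant_ideal} = boundaries ?P UNIV 0"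
  proof (intro subset_antisym subsetI)
    fix c assume "c \<in> {c \<in> tensor_chains ?P UNIV 0. aug c \<in> irrelevant_ideal}"
    then have c: "c = Poly_Mapping.single {} (lookup c {})" "lookup c {} \<in> ideal_span (range var)"
      using aug irrelevant_ideal_def by auto
    have "Poly_Mapping.single {} f \<in> boundaries ?P UNIV 0"
      if "f \<in> ideal_span (range var)" for f :: "('n, 'k) mpoly"
      using that
    proof (induction rule: ideal_span_induct_alt)
      case base
      have "0 \<in> tensor_chains ?P UNIV 1" by (simp add: tensor_chains_def)
      then have "differential ?P 0 \<in> boundaries ?P UNIV 0"
        unfolding boundaries_def One_nat_def by (rule imageI)
      then show ?case by simp
    next
      case (step r x y)
      then obtain v c where v: "x = var v" and c: "c \<in> tensor_chains ?P UNIV 1"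
        and y: "Poly_Mapping.single {} y = differential ?P c"
        by (auto simp: boundaries_def)
      have empty: "{w. w = v \<and> w < v} = {}" by auto
      have eq: "Poly_Mapping.single {} (r * x + y) = differential ?P (Poly_Mapping.single {v} r + c)"
        unfolding differential_add y[symmetric] differential_koszul_single
        by (simp add: empty v single_add)
      have "keys (Poly_Mapping.single {v} r) \<subseteq> {F. card F = Suc 0}" by auto
      moreover have "keys c \<subseteq> {F. card F = Suc 0}" using c by (simp add: tensor_chains_def)
      ultimately have "keys (Poly_Mapping.single {v} r + c) \<subseteq> {F. card F = Suc 0}"
        using keys_add[of "Poly_Mapping.single {v} r" c] by blast
      then have "Poly_Mapping.single {v} r + c \<in> tensor_chains ?P UNIV (Suc 0)"
        by (simp add: tensor_chains_def)
      then show ?case unfolding eq boundaries_def by (rule imageI)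
    qed
    with c show "c \<in> boundaries ?P UNIV 0" by metis
  next
    fix c assume "c \<in> boundaries ?P UNIV 0"
    then obtain b where b: "keys b \<subseteq> {F. card F = Suc 0}" and c: "c = differential ?P b"
      by (auto simp: boundaries_def tensor_chains_def)
    have c0: "c \<in> tensor_chains ?P UNIV 0"
      using keys_differential_koszul[OF b] by (simp add: tensor_chains_def c)
    from b have "lookup (differential ?P b) {} \<in> ideal_span (range var)"
    proof (induction rule: chain_induct)
      case zero show ?case by (simp add: ideal_span_zero)
    next
      case (add c c') then show ?case by (simp add: differential_add lookup_add ideal_span_add)
    next
      case (single F m k)
      then obtain v where "F = {v}" by (auto simp: card_Suc_eq)
      then show ?case
        by (simp add: lookup_single ideal_span_scale ideal_span_base mult.assoc[symmetric])
    qed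
    with c0 aug show "c \<in> {c \<in> tensor_chains ?P UNIV 0. aug c \<in> irrelevant_ideal}"
      by (simp add: c irrelevant_ideal_def)
  qed
  have one: "\<exists>c\<in>tensor_chains ?P UNIV 0. aug c - 1 \<in> irrelevant_ideal"
    using aug[OF chains0[of 1]] chains0[of 1]
    by (intro bexI[of _ "Poly_Mapping.single {} 1"]) (auto simp: irrelevant_ideal_def ideal_span_zero)
  show ?thesis
    unfolding resolves_residue_field_def
  proof (intro conjI exI[of _ "\<lambda>_. 1"])
    show "let aug = \<lambda>c. \<Sum>b\<in>keys c. lookup c b * 1
      in (\<exists>c\<in>tensor_chains ?P UNIV 0. aug c - 1 \<in> irrelevant_ideal) \<and>
         {c \<in> tensor_chains ?P UNIV 0. aug c \<in> irrelevant_ideal} = boundaries ?P UNIV 0"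
      using one ker unfolding aug_def Let_def by blast
  qed (use bdry0 bdry_keys hom exact in auto)
qed


section \<open>Tor, homological shift ideals and linear relations\<close>

text \<open>
  \<open>Tor\<^sub>i(K,J)\<close> is the \<open>i\<close>-th homology of \<open>P \<otimes>\<^sub>S J\<close> for a free resolution \<open>P\<close> of \<open>K\<close>;
  it is computed here with the Koszul resolution.  Elements are cosets of the module of boundaries, and a
  graded component consists of the cosets of homogeneous cycles; it is zero iff it contains
  only the coset \<open>boundaries koszul J i\<close> of \<open>0\<close>.
  As \<open>J \<subseteq> S\<close>, only degrees in \<open>nat\<close> can occur in either grading, so integer degrees are not needed.
\<close>

definition homology_component ::
  "('n, 'k::field, 'b) free_complex \<Rightarrow> ('n, 'k) mpoly set \<Rightarrow> nat \<Rightarrow>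
     (('b \<Rightarrow>\<^sub>0 ('n, 'k) mpoly) \<Rightarrow> bool) \<Rightarrow> ('b \<Rightarrow>\<^sub>0 ('n, 'k) mpoly) set set" where
  "homology_component P J i hom =
     (\<lambda>z. (\<lambda>b. z + b) ` boundaries P J i) ` {z \<in> cycles P J i. hom z}"

definition Tor_multidegree ::
  "nat \<Rightarrow> ('n::{finite,linorder}, 'k::field) mpoly set \<Rightarrow> 'n expo \<Rightarrow>
     ('n set \<Rightarrow>\<^sub>0 ('n, 'k) mpoly) set set" where
  "Tor_multidegree i J a = homology_component koszul J i (multihomogeneous koszul a)"

definition Tor_degree ::
  "nat \<Rightarrow> ('n::{finite,linorder}, 'k::field) mpoly set \<Rightarrow> nat \<Rightarrow>
     ('n set \<Rightarrow>\<^sub>0 ('n, 'k) mpoly) set set" where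
  "Tor_degree i J j = homology_component koszul J i (total_homogeneous koszul j)"

definition HS ::
  "nat \<Rightarrow> ('n::{finite,linorder}, 'k::field) mpoly set \<Rightarrow> ('n, 'k) mpoly set" where
  "HS i J = ideal_span (monom ` {a. Tor_multidegree i J a \<noteq> {boundaries koszul J i}})"

definition linearly_related :: "('n::{finite,linorder}, 'k::field) mpoly set \<Rightarrow> bool" where
  "linearly_related J \<longleftrightarrow>
     J = {0} \<or>
     (\<exists>d. generated_in_degree d J \<and>
        (\<forall>j. j \<noteq> d + 1 \<longrightarrow> Tor_degree 1 J j = {boundaries koszul J 1}))"

end

theory Submission
  imports Defs
begin

text \<open>
  In multidegree \<open>a\<close>, the space \<open>Tor\<^sub>1(K,J)\<close> of a monomial ideal \<open>J\<close> vanishes iff the graph on the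
  variables \<open>x\<^sub>v\<close> with \<open>x\<^sup>a/x\<^sub>v \<in> J\<close>, whose edges are the pairs with \<open>x\<^sup>a/x\<^sub>vx\<^sub>w \<in> J\<close>, is connected.
  If \<open>J\<close> is generated by a set \<open>G\<close> of monomials of degree \<open>d\<close>, this holds for all \<open>a\<close> of degree \<open>\<noteq> d + 1\<close>
  iff any two \<open>u, u' \<in> G\<close> dividing a monomial \<open>b\<close> are joined by a path of divisors of \<open>b\<close> in \<open>G\<close> with steps
  of the form \<open>u\<^sub>i x\<^sub>v = u\<^sub>i\<^sub>+\<^sub>1 x\<^sub>w\<close>.  For linearly related \<open>I\<close>, the ideal \<open>HS\<^sub>1(I)\<close> is generated by the least common
  multiples \<open>u\<^sub>i x\<^sub>v\<close> of such steps.  The multiples belonging to two consecutive steps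
  of a path share the divisor \<open>u\<^sub>i\<close>, so they are themselves one step apart; hence a path for \<open>I\<close> yields a path for
  \<open>HS\<^sub>1(I)\<close>.
\<close>

section \<open>Connectivity in Koszul degrees and in swap graphs\<close>

definition unit_expo :: "'n \<Rightarrow> 'n expo" where
  "unit_expo v = Poly_Mapping.single v 1"

definition expo_le :: "'n expo \<Rightarrow> 'n expo \<Rightarrow> bool" where
  "expo_le a b \<longleftrightarrow> (\<forall>v. lookup a v \<le> lookup b v)"

text \<open>These are the exponents of all monomials in the ideal generated by the monomials with
  exponents in \<open>G\<close>.\<close>

definition up_closure :: "'n expo set \<Rightarrow> 'n expo set" where
  "up_closure G = {m. \<exists>u\<in>G. expo_le u m}"

lemma lookup_unit_expo: "lookup (unit_expo v) w = (if v = w then 1 else 0)"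
  by (simp add: unit_expo_def lookup_single when_def)

lemma total_degree_add [simp]: "total_degree (a + b) = total_degree a + total_degree b"
  by (simp add: total_degree_def lookup_add sum.distrib)

lemma total_degree_unit_expo [simp]: "total_degree (unit_expo v) = 1"
  by (simp add: total_degree_def lookup_unit_expo)

lemma expo_le_refl [simp]: "expo_le a a"
  by (simp add: expo_le_def)

lemma expo_le_trans [trans]: "expo_le a b \<Longrightarrow> expo_le b c \<Longrightarrow> expo_le a c"
  unfolding expo_le_def by (meson le_trans)

lemma expo_le_add1 [simp]: "expo_le a (a + b)"
  by (simp add: expo_le_def lookup_add)

lemma expo_le_imp_add:
  assumes "expo_le a b"
  obtains t where "b = a + t"
proof
  show "b = a + (b - a)"
    using assms by (intro poly_mapping_eqI) (simp add: expo_le_def lookup_add lookup_minus)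
qed

text \<open>A proper divisor of x^b still divides x^b/x_v for some variable x_v; this is how one
  descends by one degree below.\<close>

lemma expo_le_cases:
  assumes "expo_le a b" "a \<noteq> b"
  obtains v m where "b = m + unit_expo v" "expo_le a m"
proof -
  obtain t where t: "b = a + t" using expo_le_imp_add[OF assms(1)] .
  with assms(2) have "t \<noteq> 0" by auto
  then obtain v where v: "lookup t v \<noteq> 0" by (metis poly_mapping_eqI lookup_zero)
  have "t = (t - unit_expo v) + unit_expo v"
    using v by (intro poly_mapping_eqI) (auto simp: lookup_add lookup_minus lookup_unit_expo)
  with t have "b = (a + (t - unit_expo v)) + unit_expo v" by (simp add: add.assoc)
  then show thesis by (rule that) simp
qed

lemma total_degree_mono: "expo_le a b \<Longrightarrow> total_degree a \<le> total_degree b"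
  by (elim expo_le_imp_add) simp

lemma expo_le_antisym_degree:
  assumes "expo_le a b" "total_degree a = total_degree b"
  shows "a = b"
proof -
  obtain t where t: "b = a + t" using expo_le_imp_add[OF assms(1)] .
  then have "total_degree t = 0" using assms by simp
  then have "t = 0" by (intro poly_mapping_eqI) (simp add: total_degree_def)
  with t show ?thesis by simp
qed

lemma up_closure_base: "u \<in> G \<Longrightarrow> u \<in> up_closure G"
  by (auto simp: up_closure_def intro: expo_le_refl)

lemma up_closure_add: "m \<in> up_closure G \<Longrightarrow> m + t \<in> up_closure G"
  unfolding up_closure_def using expo_le_trans expo_le_add1 by blast

text \<open>The exponent \<open>p\<close> is the one of \<open>gcd (m, m')\<close>.\<close>

lemma common_lower:
  assumes "m + unit_expo v = m' + unit_expo w" "v \<noteq> w"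
  obtains p where "m = p + unit_expo w" "m' = p + unit_expo v"
    "\<And>u. expo_le u m \<Longrightarrow> expo_le u m' \<Longrightarrow> expo_le u p"
proof
  have *: "lookup m i + (if v = i then 1 else 0) = lookup m' i + (if w = i then 1 else 0)" for i
    using arg_cong[OF assms(1), of "\<lambda>x. lookup x i"] by (simp add: lookup_add lookup_unit_expo)
  have m: "lookup m w = Suc (lookup m' w)" using *[of w] assms(2) by simp
  show 1: "m = (m - unit_expo w) + unit_expo w"
    using m by (intro poly_mapping_eqI) (auto simp: lookup_add lookup_minus lookup_unit_expo)
  have "m' + unit_expo w = ((m - unit_expo w) + unit_expo v) + unit_expo w"
    using assms(1) by (metis 1 add.assoc add.commute)
  then show "m' = (m - unit_expo w) + unit_expo v" by simp
  show "expo_le u (m - unit_expo w)" if "expo_le u m" "expo_le u m'" for u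
    unfolding expo_le_def
  proof
    fix i
    show "lookup u i \<le> lookup (m - unit_expo w) i"
      using that[unfolded expo_le_def, rule_format, of i] *[of i] assms(2)
      by (auto simp: lookup_minus lookup_unit_expo split: if_splits)
  qed
qed

section \<open>The two graphs\<close>

text \<open>A pair \<open>(v, m)\<close> stands for the basis element \<open>x\<^sup>m e\<^sub>v\<close> of the Koszul chains of degree one;
  its multidegree is \<open>m + unit_expo v\<close>.  Edges are the boundaries of basis elements \<open>x\<^sup>p e\<^sub>v \<and> e\<^sub>w\<close>.\<close>

definition koszul_edge :: "'n expo set \<Rightarrow> (('n \<times> 'n expo) \<times> ('n \<times> 'n expo)) set" where
  "koszul_edge M =
     {((v, m), (w, m')). v \<noteq> w \<and> (\<exists>p\<in>M. m = p + unit_expo w \<and> m' = p + unit_expo v)}"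

text \<open>\<open>koszul_edge\<close> is symmetric and preserves multidegrees, so its reflexive
  transitive closure is connectedness within multidegree \<open>a\<close>. A multidegree without
  vertices counts as connected.\<close>

definition koszul_connected :: "'n expo set \<Rightarrow> 'n expo \<Rightarrow> bool" where
  "koszul_connected M a \<longleftrightarrow> (\<forall>v m w m'. m \<in> M \<longrightarrow> m' \<in> M \<longrightarrow> m + unit_expo v = a \<longrightarrow>
     m' + unit_expo w = a \<longrightarrow> ((v, m), (w, m')) \<in> (koszul_edge M)\<^sup>*)"

text \<open>The case \<open>v = w\<close> only adds loops, which do not change the reflexive
  transitive closure.\<close>

definition swap_edge :: "'n expo set \<Rightarrow> 'n expo \<Rightarrow> ('n expo \<times> 'n expo) set" where
  "swap_edge G b = {(u, u'). u \<in> G \<and> u' \<in> G \<and> expo_le u b \<and> expo_le u' b \<and>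
     (\<exists>v w. u + unit_expo v = u' + unit_expo w)}"

definition swap_connected :: "'n expo set \<Rightarrow> bool" where
  "swap_connected G \<longleftrightarrow> (\<forall>b u u'. u \<in> G \<longrightarrow> u' \<in> G \<longrightarrow> expo_le u b \<longrightarrow> expo_le u' b \<longrightarrow>
     (u, u') \<in> (swap_edge G b)\<^sup>*)"

section \<open>Comparison of Koszul paths and swap paths\<close>

lemma swap_edge_mono: "expo_le a b \<Longrightarrow> swap_edge G a \<subseteq> swap_edge G b"
  unfolding swap_edge_def using expo_le_trans by blast

lemma koszul_edge_sum:
  "((v, m), (w, m')) \<in> (koszul_edge M)\<^sup>* \<Longrightarrow> m + unit_expo v = m' + unit_expo w"
proof (induction rule: rtrancl_induct2)
  case (step x n y n')
  then show ?case by (auto simp: koszul_edge_def algebra_simps)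
qed simp

text \<open>A common divisor of x^m and x^m' divides their gcd x^p, so \<open>p\<close> lies in the
  up-closure and yields an edge. Thus the vertices of one multidegree above a fixed generator form a
  clique.\<close>

lemma koszul_edge_clique:
  assumes "u \<in> G" "expo_le u m" "expo_le u m'" "m + unit_expo v = m' + unit_expo w"
  shows "((v, m), (w, m')) \<in> (koszul_edge (up_closure G))\<^sup>*"
proof (cases "v = w")
  case False
  then obtain p where "m = p + unit_expo w" "m' = p + unit_expo v" "expo_le u p"
    using common_lower[OF assms(4)] assms(2,3) by metis
  with False assms(1) show ?thesis
    by (intro r_into_rtrancl) (auto simp: koszul_edge_def up_closure_def)
qed (use assms(4) in auto)

text \<open>Induction on the degree of \<open>b\<close>. In degree \<open>d + 1\<close>, any two
  generators dividing x^b are at most one swap apart. Otherwise a Koszul path in multidegree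
  \<open>b\<close> is followed: each edge carries a generator dividing both of its ends, and
  generators of consecutive edges divide a common x^b/x_v, where the induction hypothesis
  applies.\<close>

lemma swap_connected_if_koszul_connected:
  fixes G :: "'n::finite expo set"
  assumes deg: "\<And>u. u \<in> G \<Longrightarrow> total_degree u = d"
    and conn: "\<And>b. total_degree b \<noteq> d + 1 \<Longrightarrow> koszul_connected (up_closure G) b"
  shows "swap_connected G"
proof -
  have "(u, u') \<in> (swap_edge G b)\<^sup>*"
    if "u \<in> G" "u' \<in> G" "expo_le u b" "expo_le u' b" for u u' b
    using that
  proof (induction "total_degree b" arbitrary: b u u' rule: less_induct)
    case less
    show ?case
    proof (cases "u = b \<or> u' = b")
      case True
      \<comment> \<open>Then \<open>b\<close> has degree \<open>d\<close>, so both generators equal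
        \<open>b\<close>.\<close>
      then have "u = u'" using less.prems deg expo_le_antisym_degree by metis
      then show ?thesis by simp
    next
      case False
      obtain v m where m: "b = m + unit_expo v" "expo_le u m"
        using expo_le_cases[OF less.prems(3)] False by metis
      obtain w m' where m': "b = m' + unit_expo w" "expo_le u' m'"
        using expo_le_cases[OF less.prems(4)] False by metis
      show ?thesis
      proof (cases "total_degree b = d + 1")
        case True
        have "total_degree m = d" "total_degree m' = d" using True m(1) m'(1) by (metis total_degree_add total_degree_unit_expo add_right_cancel)+
        with m(2) m'(2) deg less.prems have "u = m" "u' = m'"
          by (metis expo_le_antisym_degree)+
        then have "u + unit_expo v = u' + unit_expo w" using m m' by simp
        with less.prems show ?thesis by (intro r_into_rtrancl) (auto simp: swap_edge_def)
      next
        case False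
        have lower: "(g, h) \<in> (swap_edge G b)\<^sup>*"
          if "g \<in> G" "h \<in> G" "expo_le g q" "expo_le h q" "q + unit_expo x = b" for g h q x
        proof -
          have "total_degree q < total_degree b" using that(5) by auto
          then have "(g, h) \<in> (swap_edge G q)\<^sup>*" using less.hyps that by blast
          then show ?thesis using rtrancl_mono[OF swap_edge_mono[of q b G]] that(5) by auto
        qed
        have "m \<in> up_closure G" "m' \<in> up_closure G"
          using m(2) m'(2) less.prems by (auto simp: up_closure_def)
        then have "((v, m), (w, m')) \<in> (koszul_edge (up_closure G))\<^sup>*"
          using conn[OF False] m(1) m'(1) by (simp add: koszul_connected_def)
        \<comment> \<open>The claim covers every generator dividing the current end of the path,
          since no generator is distinguished at the inner vertices.\<close>
        then have "g \<in> G \<Longrightarrow> expo_le g m' \<Longrightarrow> (u, g) \<in> (swap_edge G b)\<^sup>*" for g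
        proof (induction arbitrary: g rule: rtrancl_induct2)
          case refl
          then show ?case using lower[of u g m v] less.prems m by simp
        next
          case (step x n y n')
          from step.hyps(2) obtain p where p: "p \<in> up_closure G" "n = p + unit_expo y" "n' = p + unit_expo x"
            by (auto simp: koszul_edge_def)
          then obtain h where h: "h \<in> G" "expo_le h p" by (auto simp: up_closure_def)
          then have hn: "expo_le h n" "expo_le h n'" using p(2,3) by (auto intro: expo_le_trans)
          have "n + unit_expo x = b" using koszul_edge_sum[OF step.hyps(1)] m by simp
          then have "n' + unit_expo y = b" using p by (simp add: algebra_simps)
          then have "(h, g) \<in> (swap_edge G b)\<^sup>*" using lower h hn step.prems by blast
          with step.IH[OF h(1) hn(1)] show ?case by (rule rtrancl_trans)
        qed
        with less.prems m' show ?thesis by blast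
      qed
    qed
  qed
  then show ?thesis by (simp add: swap_connected_def)
qed

text \<open>A swap path between generators below \<open>m\<close> and \<open>m'\<close> is lifted.
  The lcm of a swap has degree \<open>d + 1\<close>, hence properly divides x^a when the degree of
  \<open>a\<close> is larger; so some x^a/x_v is a multiple of both generators and links their
  cliques.\<close>

lemma koszul_connected_if_swap_connected:
  fixes G :: "'n::finite expo set"
  assumes deg: "\<And>u. u \<in> G \<Longrightarrow> total_degree u = d"
    and conn: "swap_connected G" and a: "total_degree a \<noteq> d + 1"
  shows "koszul_connected (up_closure G) a"
  unfolding koszul_connected_def
proof (intro allI impI)
  fix v m w m' assume m: "m \<in> up_closure G" "m + unit_expo v = a"
    and m': "m' \<in> up_closure G" "m' + unit_expo w = a"
  from m obtain p where p: "p \<in> G" "expo_le p m" by (auto simp: up_closure_def)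
  from m' obtain q where q: "q \<in> G" "expo_le q m'" by (auto simp: up_closure_def)
  have "total_degree a \<ge> d + 1"
    using total_degree_mono[OF p(2)] deg[OF p(1)] m(2) by auto
  with a have big: "total_degree a > d + 1" by simp
  have "expo_le p a" "expo_le q a"
    using expo_le_trans[OF p(2), of a] expo_le_trans[OF q(2), of a] m(2) m'(2)
    by (metis expo_le_add1)+
  then have "(p, q) \<in> (swap_edge G a)\<^sup>*" using conn p q by (simp add: swap_connected_def)
  then have "expo_le q n \<Longrightarrow> n + unit_expo y = a \<Longrightarrow> ((v, m), (y, n)) \<in> (koszul_edge (up_closure G))\<^sup>*" for y n
  proof (induction arbitrary: y n rule: rtrancl_induct)
    case base
    then show ?case using koszul_edge_clique p m by metis
  next
    case (step g g')
    then obtain s t where g: "g \<in> G" "g' \<in> G" "expo_le g a" "expo_le g' a" "g + unit_expo s = g' + unit_expo t"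
      by (auto simp: swap_edge_def)
    show ?case
    proof (cases "s = t")
      case True
      with g have "g = g'" by simp
      with step show ?thesis by blast
    next
      case False
      then obtain r where r: "g = r + unit_expo t" "g' = r + unit_expo s" using common_lower g(5) by metis
      \<comment> \<open>As \<open>s\<close> and \<open>t\<close> differ, g x_s is the lcm of
        \<open>g\<close> and \<open>g'\<close>, and both divide x^a.\<close>
      have "expo_le (g + unit_expo s) a"
        unfolding expo_le_def
      proof
        fix i show "lookup (g + unit_expo s) i \<le> lookup a i"
          using g(3,4) False unfolding expo_le_def r lookup_add lookup_unit_expo
          by (cases "i = s"; cases "i = t") (auto dest: spec[of _ i])
      qed
      moreover have "g + unit_expo s \<noteq> a" using big deg[OF g(1)] by auto
      ultimately obtain x n0 where x: "a = n0 + unit_expo x" "expo_le (g + unit_expo s) n0"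
        using expo_le_cases by metis
      have le: "expo_le g n0" "expo_le g' n0"
        using x(2) g(5) expo_le_trans expo_le_add1 by metis+
      have "((v, m), (x, n0)) \<in> (koszul_edge (up_closure G))\<^sup>*" using step.IH le x by blast
      also have "((x, n0), (y, n)) \<in> (koszul_edge (up_closure G))\<^sup>*"
        using koszul_edge_clique[OF g(2) le(2) step.prems(1)] step.prems(2) x(1) by simp
      finally show ?thesis .
    qed
  qed
  with q m' show "((v, m), (w, m')) \<in> (koszul_edge (up_closure G))\<^sup>*" by blast
qed

section \<open>Passage to the least common multiples of swaps\<close>

definition swap_lcms :: "'n expo set \<Rightarrow> 'n expo set" where
  "swap_lcms G = {a. \<exists>u\<in>G. \<exists>u'\<in>G. \<exists>v w. v \<noteq> w \<and> a = u + unit_expo v \<and> a = u' + unit_expo w}"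

lemma swap_connected_swap_lcms:
  fixes G :: "'n::finite expo set"
  assumes conn: "swap_connected G"
  shows "swap_connected (swap_lcms G)"
proof -
  let ?R = "\<lambda>b. swap_edge (swap_lcms G) b"
  \<comment> \<open>Two multiples of the same \<open>u\<close> by one variable each are at most one
    swap apart.\<close>
  have star: "(p, q) \<in> (?R b)\<^sup>*"
    if "p \<in> swap_lcms G" "q \<in> swap_lcms G" "expo_le p b" "expo_le q b" "p = u + unit_expo s" "q = u + unit_expo t"
    for p q b u s t
  proof -
    have "p + unit_expo t = q + unit_expo s" using that by (simp add: algebra_simps)
    with that show ?thesis by (intro r_into_rtrancl) (auto simp: swap_edge_def)
  qed
  have "(p, q) \<in> (?R b)\<^sup>*"
    if pq: "p \<in> swap_lcms G" "q \<in> swap_lcms G" "expo_le p b" "expo_le q b" for p q b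
  proof -
    obtain u s where u: "u \<in> G" "p = u + unit_expo s" using pq by (auto simp: swap_lcms_def)
    obtain u' t where u': "u' \<in> G" "q = u' + unit_expo t" using pq(2) by (auto simp: swap_lcms_def)
    have "expo_le u b" "expo_le u' b" using u u' pq expo_le_trans expo_le_add1 by blast+
    then have "(u, u') \<in> (swap_edge G b)\<^sup>*" using conn u u' by (simp add: swap_connected_def)
    \<comment> \<open>The end \<open>q\<close> varies in the induction: at an inner vertex
      \<open>g\<close> of the path, the hypothesis is used for the lcm of \<open>g\<close> and its
      successor.\<close>
    then show ?thesis using pq(2,4) u'(2)
    proof (induction arbitrary: q t rule: rtrancl_induct)
      case base
      then show ?case using star pq u by blast
    next
      case (step g g')
      then obtain x y where g: "g \<in> G" "g' \<in> G" "expo_le g b" "expo_le g' b" "g + unit_expo x = g' + unit_expo y"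
        by (auto simp: swap_edge_def)
      show ?case
      proof (cases "x = y")
        case True
        with g have "g = g'" by simp
        with step show ?thesis by blast
      next
        case False
        then obtain r where r: "g = r + unit_expo y" "g' = r + unit_expo x" using common_lower g(5) by metis
        have le: "expo_le (g + unit_expo x) b"
          unfolding expo_le_def
        proof
          fix i show "lookup (g + unit_expo x) i \<le> lookup b i"
            using g(3,4) False unfolding expo_le_def r lookup_add lookup_unit_expo
            by (cases "i = x"; cases "i = y") (auto dest: spec[of _ i])
        qed
        have W: "g + unit_expo x \<in> swap_lcms G" using g False unfolding swap_lcms_def by blast
        have "(p, g + unit_expo x) \<in> (?R b)\<^sup>*" using step.IH[OF W le] by blast
        also have "(g + unit_expo x, q) \<in> (?R b)\<^sup>*" using star[OF W step.prems(1) le step.prems(2) g(5) step.prems(3)] .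
        finally show ?thesis .
      qed
    qed
  qed
  then show ?thesis by (simp add: swap_connected_def)
qed


section \<open>Koszul homology of monomial ideals in degree one\<close>

definition exponent_ideal :: "'n expo set \<Rightarrow> ('n, 'k::field) mpoly set" where
  "exponent_ideal M = {f. keys f \<subseteq> M}"

lemma exponent_ideal_zero [simp]: "0 \<in> exponent_ideal M"
  by (simp add: exponent_ideal_def)

lemma exponent_ideal_add: "f \<in> exponent_ideal M \<Longrightarrow> g \<in> exponent_ideal M \<Longrightarrow> f + g \<in> exponent_ideal M"
  unfolding exponent_ideal_def using keys_add[of f g] by blast

lemma exponent_ideal_uminus: "f \<in> exponent_ideal M \<Longrightarrow> - f \<in> exponent_ideal M"
  by (simp add: exponent_ideal_def)

lemma exponent_ideal_single: "m \<in> M \<Longrightarrow> Poly_Mapping.single m k \<in> exponent_ideal M"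
  by (simp add: exponent_ideal_def)

lemma exponent_ideal_mult:
  assumes "f \<in> exponent_ideal (up_closure G)"
  shows "r * f \<in> exponent_ideal (up_closure G)"
  using assms keys_mult[of r f] up_closure_add[of _ G]
  unfolding exponent_ideal_def by (force simp: add.commute)

text \<open>Membership in a monomial ideal is decided term by term, each term being a multiple of a
  generator. For arbitrary \<open>M\<close>, \<open>exponent_ideal M\<close> is only a K-subspace,
  which suffices for many of the chain-level lemmas.\<close>

lemma ideal_span_monom: "ideal_span (monom ` G) = (exponent_ideal (up_closure G) :: ('n, 'k::field) mpoly set)"
proof (intro subset_antisym subsetI)
  fix f :: "('n, 'k) mpoly"
  assume "f \<in> ideal_span (monom ` G)"
  then show "f \<in> exponent_ideal (up_closure G)"
  proof (induction rule: ideal_span_induct_alt)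
    case (step r x y)
    then have "x \<in> exponent_ideal (up_closure G)"
      by (auto intro: exponent_ideal_single up_closure_base)
    with step show ?case by (intro exponent_ideal_add exponent_ideal_mult)
  qed simp
next
  fix f :: "('n, 'k) mpoly"
  assume f: "f \<in> exponent_ideal (up_closure G)"
  have single: "Poly_Mapping.single m k \<in> ideal_span (monom ` G)" if "m \<in> up_closure G" for m and k :: 'k
  proof -
    obtain u where "u \<in> G" "expo_le u m"
      using \<open>m \<in> up_closure G\<close> by (auto simp: up_closure_def)
    moreover from this(2) obtain t where "m = u + t" by (rule expo_le_imp_add)
    ultimately have "Poly_Mapping.single m k = Poly_Mapping.single t k * monom u"
      by (simp add: mult_single add.commute)
    with \<open>u \<in> G\<close> show ?thesis by (simp add: ideal_span_scale ideal_span_base)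
  qed
  have sum: "sum h X \<in> ideal_span (monom ` G)"
    if "\<And>x. x \<in> X \<Longrightarrow> h x \<in> ideal_span (monom ` G)" for h :: "'n expo \<Rightarrow> ('n, 'k) mpoly" and X
    using that by (induction X rule: infinite_finite_induct) (auto intro: ideal_span_zero ideal_span_add)
  have "(\<Sum>m\<in>keys f. Poly_Mapping.single m (lookup f m)) \<in> ideal_span (monom ` G)"
    using f by (intro sum single) (auto simp: exponent_ideal_def)
  then show "f \<in> ideal_span (monom ` G)" by (simp add: sum_single_keys)
qed

lemma exponent_ideal_generated_in_degree:
  assumes J: "J = (exponent_ideal (up_closure A) :: ('n::finite, 'k::field) mpoly set)"
    and gen: "generated_in_degree d J"
  shows "J = exponent_ideal (up_closure {m \<in> up_closure A. total_degree m = d})"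
    (is "_ = exponent_ideal (up_closure ?G)")
proof
  obtain B where B: "\<And>g. g \<in> B \<Longrightarrow> homogeneous d g" "J = ideal_span B"
    using gen by (auto simp: generated_in_degree_def)
  show "J \<subseteq> exponent_ideal (up_closure ?G)"
  proof
    fix f assume "f \<in> J"
    then have "f \<in> ideal_span B" using B by simp
    then show "f \<in> exponent_ideal (up_closure ?G)"
    proof (induction rule: ideal_span_induct_alt)
      case (step r x y)
      have "x \<in> J" using B(2) step(1) by (simp add: ideal_span_base)
      \<comment> \<open>The homogeneous generator \<open>x\<close> need not be a monomial, but a
        monomial ideal contains every monomial of its elements.\<close>
      then have "keys x \<subseteq> ?G"
        using B(1)[OF step(1)] unfolding J exponent_ideal_def homogeneous_def by blast
      then have "x \<in> exponent_ideal (up_closure ?G)"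
        unfolding exponent_ideal_def up_closure_def using expo_le_refl by blast
      with step show ?case by (intro exponent_ideal_add exponent_ideal_mult)
    qed simp
  qed
  have "up_closure ?G \<subseteq> up_closure A"
    unfolding up_closure_def using expo_le_trans by blast
  then show "exponent_ideal (up_closure ?G) \<subseteq> J"
    unfolding J exponent_ideal_def by blast
qed

lemma generated_in_degree_exponent_ideal:
  assumes "\<And>u. u \<in> G \<Longrightarrow> total_degree u = d"
  shows "generated_in_degree d (exponent_ideal (up_closure G) :: ('n::finite, 'k::field) mpoly set)"
  unfolding generated_in_degree_def
  using assms by (intro exI[of _ "monom ` G"]) (simp add: ideal_span_monom homogeneous_def)

text \<open>Unlike \<open>chain_induct\<close>, this induction keeps track of the exponents too, so
  that the single terms stay inside the ideal.\<close>

lemma chain_induct_terms [consumes 1, case_names zero add single]: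
  fixes c :: "'b \<Rightarrow>\<^sub>0 ('m \<Rightarrow>\<^sub>0 'k::comm_monoid_add)"
  assumes A: "{(b, m). m \<in> keys (lookup c b)} \<subseteq> A"
    and "P 0" "\<And>c c'. P c \<Longrightarrow> P c' \<Longrightarrow> P (c + c')"
    and gen: "\<And>b m k. (b, m) \<in> A \<Longrightarrow> P (Poly_Mapping.single b (Poly_Mapping.single m k))"
  shows "P c"
proof -
  have sum_P: "P (sum f X)" if "\<And>x. x \<in> X \<Longrightarrow> P (f x)" for f :: "'z \<Rightarrow> 'b \<Rightarrow>\<^sub>0 ('m \<Rightarrow>\<^sub>0 'k)" and X
    using that by (induction X rule: infinite_finite_induct) (auto intro: assms(2,3))
  have "Poly_Mapping.single b (sum f X) = (\<Sum>x\<in>X. Poly_Mapping.single b (f x))"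
    for b :: 'b and f :: "'m \<Rightarrow> ('m \<Rightarrow>\<^sub>0 'k)" and X
    by (induction X rule: infinite_finite_induct) (simp_all add: single_add)
  then have "c = (\<Sum>b\<in>keys c. \<Sum>m\<in>keys (lookup c b).
      Poly_Mapping.single b (Poly_Mapping.single m (lookup (lookup c b) m)))"
    by (metis (no_types, lifting) sum.cong sum_single_keys)
  also have "P \<dots>"
    by (intro sum_P gen subsetD[OF A]) simp
  finally show ?thesis .
qed

section \<open>Boundaries and vanishing homology\<close>

lemma differential_uminus: "differential P (- c) = - differential P c"
  by (simp add: eq_neg_iff_add_eq_0 flip: differential_add)

lemma differential_diff: "differential P (c - c') = differential P c - differential P c'"
  using differential_add[of P c "- c'"] by (simp add: differential_uminus)

lemma boundaries_zero [simp]: "0 \<in> boundaries P (exponent_ideal M) i"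
  unfolding boundaries_def by (rule image_eqI[of _ _ 0]) (simp_all add: tensor_chains_def)

lemma boundaries_add:
  assumes "x \<in> boundaries P (exponent_ideal M) i" "y \<in> boundaries P (exponent_ideal M) i"
  shows "x + y \<in> boundaries P (exponent_ideal M) i"
proof -
  obtain c c' where c: "c \<in> tensor_chains P (exponent_ideal M) (Suc i)" "x = differential P c"
    "c' \<in> tensor_chains P (exponent_ideal M) (Suc i)" "y = differential P c'"
    using assms by (auto simp: boundaries_def)
  have "c + c' \<in> tensor_chains P (exponent_ideal M) (Suc i)"
    using c(1,3) keys_add[of c c'] unfolding tensor_chains_def
    by (auto simp: lookup_add intro: exponent_ideal_add)
  then show ?thesis
    unfolding boundaries_def c(2,4) differential_add[symmetric] by (rule imageI)
qed

lemma boundaries_uminus: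
  assumes "x \<in> boundaries P (exponent_ideal M) i"
  shows "- x \<in> boundaries P (exponent_ideal M) i"
proof -
  obtain c where c: "c \<in> tensor_chains P (exponent_ideal M) (Suc i)" "x = differential P c"
    using assms by (auto simp: boundaries_def)
  have "- c \<in> tensor_chains P (exponent_ideal M) (Suc i)"
    using c(1) unfolding tensor_chains_def by (auto intro: exponent_ideal_uminus)
  then show ?thesis
    unfolding boundaries_def c(2) differential_uminus[symmetric] by (rule imageI)
qed

text \<open>A coset is trivial iff its representative is a boundary. The assumption
  \<open>hom 0\<close> makes the set of cosets nonempty.\<close>

lemma homology_component_trivial_iff:
  assumes "hom 0"
  shows "homology_component P (exponent_ideal M) i hom = {boundaries P (exponent_ideal M) i} \<longleftrightarrow>
    (\<forall>z\<in>cycles P (exponent_ideal M) i. hom z \<longrightarrow> z \<in> boundaries P (exponent_ideal M) i)"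
    (is "?H = {?B} \<longleftrightarrow> ?R")
proof
  assume H: "?H = {?B}"
  show ?R
  proof (intro ballI impI)
    fix z assume "z \<in> cycles P (exponent_ideal M) i" "hom z"
    then have "(\<lambda>b. z + b) ` ?B \<in> ?H" by (auto simp: homology_component_def)
    then have "(\<lambda>b. z + b) ` ?B = ?B" using H by simp
    moreover have "z + 0 \<in> (\<lambda>b. z + b) ` ?B" by (rule imageI) simp
    ultimately show "z \<in> ?B" by simp
  qed
next
  assume R: ?R
  have coset: "(\<lambda>b. z + b) ` ?B = ?B" if z: "z \<in> ?B" for z
  proof (intro subset_antisym subsetI)
    fix x assume "x \<in> ?B"
    then have "- z + x \<in> ?B" using z by (intro boundaries_add boundaries_uminus)
    then have "z + (- z + x) \<in> (\<lambda>b. z + b) ` ?B" by (rule imageI)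
    then show "x \<in> (\<lambda>b. z + b) ` ?B" by simp
  qed (use z in \<open>auto intro: boundaries_add\<close>)
  have "0 \<in> {z \<in> cycles P (exponent_ideal M) i. hom z}"
    using assms by (simp add: cycles_def tensor_chains_def)
  moreover have "(\<lambda>b. z + b) ` ?B = ?B" if "z \<in> {z \<in> cycles P (exponent_ideal M) i. hom z}" for z
    using that R coset by blast
  ultimately show "?H = {?B}"
    unfolding homology_component_def by (metis (no_types, lifting) image_cong image_constant)
qed

section \<open>Paths as boundaries in the Koszul complex\<close>

lemma bdeg_koszul_singleton: "bdeg koszul {v} = unit_expo v"
  by (simp add: unit_expo_def)

lemma differential_koszul_singleton:
  "differential koszul (Poly_Mapping.single {v} (Poly_Mapping.single m k)) =
     Poly_Mapping.single {} (Poly_Mapping.single (m + unit_expo v) (k :: 'k::field))"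
proof -
  have *: "{w. w = v \<and> w < v} = {}" by auto
  show ?thesis
    unfolding differential_koszul_single neg1_power_times_single_var by (simp add: unit_expo_def *)
qed

lemma differential_koszul_doubleton:
  assumes "s < t"
  shows "differential koszul (Poly_Mapping.single {s, t} (Poly_Mapping.single m k)) =
     Poly_Mapping.single {t} (Poly_Mapping.single (m + unit_expo s) k) -
     Poly_Mapping.single {s} (Poly_Mapping.single (m + unit_expo t) (k :: 'k::field))"
proof -
  have *: "{w. (w = s \<or> w = t) \<and> w < s} = {}" "{w. (w = s \<or> w = t) \<and> w < t} = {s}"
    "{s, t} - {s} = {t}" "{s, t} - {t} = {s}"
    using assms by auto
  have "s \<noteq> t" using assms by simp
  then show ?thesis
    unfolding differential_koszul_single neg1_power_times_single_var
    by (simp add: unit_expo_def single_uminus *)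
qed

text \<open>The differences along a path telescope, and each edge contributes a boundary up to
  sign.\<close>

lemma boundary_koszul_edge:
  fixes k :: "'k::field"
  assumes "((v, m), (w, m')) \<in> (koszul_edge M)\<^sup>*"
  shows "Poly_Mapping.single {v} (Poly_Mapping.single m k) -
    Poly_Mapping.single {w} (Poly_Mapping.single m' k) \<in> boundaries koszul (exponent_ideal M) 1"
  using assms
proof (induction rule: rtrancl_induct2)
  case (step x n y n')
  obtain p where p: "x \<noteq> y" "p \<in> M" "n = p + unit_expo y" "n' = p + unit_expo x"
    using step.hyps(2) by (auto simp: koszul_edge_def)
  have edge: "differential koszul (Poly_Mapping.single {s, t} (Poly_Mapping.single p l))
      \<in> boundaries koszul (exponent_ideal M) 1" if "s \<noteq> t" for s t and l :: 'k
    unfolding boundaries_def using p(2) that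
    by (intro imageI) (auto simp: tensor_chains_def lookup_single when_def card_insert_if
        intro: exponent_ideal_single)
  have "Poly_Mapping.single {x} (Poly_Mapping.single n k) -
    Poly_Mapping.single {y} (Poly_Mapping.single n' k) \<in> boundaries koszul (exponent_ideal M) 1"
  \<comment> \<open>The order of the variables decides the sign in the Koszul differential.\<close>
  proof (cases "x < y")
    case True
    then show ?thesis
      using boundaries_uminus[OF edge[OF p(1), of k]]
      by (simp add: differential_koszul_doubleton p(3,4) del: differential_single)
  next
    case False
    with p(1) have "y < x" by simp
    then show ?thesis
      using edge[OF p(1)[symmetric], of k]
      by (simp add: differential_koszul_doubleton p(3,4) del: differential_single)
  qed
  from boundaries_add[OF step.IH this] show ?case by simp
qed simp

definition coeff_sum :: "('b \<times> 'm) set \<Rightarrow> ('b \<Rightarrow>\<^sub>0 ('m \<Rightarrow>\<^sub>0 'k)) \<Rightarrow> 'k::field" where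
  "coeff_sum C c = (\<Sum>b\<in>keys c. \<Sum>m\<in>keys (lookup c b). if (b, m) \<in> C then lookup (lookup c b) m else 0)"

lemma coeff_sum_0 [simp]: "coeff_sum C 0 = 0"
  by (simp add: coeff_sum_def)

lemma coeff_sum_add: "coeff_sum C (c + c') = coeff_sum C c + coeff_sum C c'"
  unfolding coeff_sum_def
  by (rule setsum_keys_plus_distrib[where f = "\<lambda>b p. \<Sum>m\<in>keys p. if (b, m) \<in> C then lookup p m else 0"])
    (auto intro!: setsum_keys_plus_distrib[where f = "\<lambda>m l. if (b, m) \<in> C then l else 0" for b])

lemma coeff_sum_diff: "coeff_sum C (c - c') = coeff_sum C c - coeff_sum C c'"
  using coeff_sum_add[of C "c - c'" c'] by simp

lemma coeff_sum_single:
  "coeff_sum C (Poly_Mapping.single b (Poly_Mapping.single m k)) = (if (b, m) \<in> C then k else 0)"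
  by (cases "k = 0") (simp_all add: coeff_sum_def single_eq_0_iff)

text \<open>The coefficient sum along a connected component vanishes on boundaries.\<close>

lemma koszul_edge_if_boundary:
  assumes "Poly_Mapping.single {v} (Poly_Mapping.single m (1 :: 'k::field)) -
    Poly_Mapping.single {w} (Poly_Mapping.single m' 1) \<in> boundaries koszul (exponent_ideal M) 1"
  shows "((v, m), (w, m')) \<in> (koszul_edge M)\<^sup>*"
proof (rule ccontr)
  assume no: "((v, m), (w, m')) \<notin> (koszul_edge M)\<^sup>*"
  define C where "C = {({x}, n) | x n. ((v, m), (x, n)) \<in> (koszul_edge M)\<^sup>*}"
  obtain c where c: "c \<in> tensor_chains koszul (exponent_ideal M) (Suc 1)"
    and d: "Poly_Mapping.single {v} (Poly_Mapping.single m (1 :: 'k)) -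
      Poly_Mapping.single {w} (Poly_Mapping.single m' 1) = differential koszul c"
    using assms unfolding boundaries_def by blast
  have "{(F, p). p \<in> keys (lookup c F)} \<subseteq> {(F, p). card F = 2 \<and> p \<in> M}"
  proof clarify
    fix F p assume p: "p \<in> keys (lookup c F)"
    then have "F \<in> keys c" by (metis in_keys_iff keys_zero empty_iff)
    with p c show "card F = 2 \<and> p \<in> M" by (auto simp: tensor_chains_def exponent_ideal_def)
  qed
  then have "coeff_sum C (differential koszul c) = 0"
  proof (induction rule: chain_induct_terms)
    case (add c c')
    then show ?case by (simp add: differential_add coeff_sum_add)
  next
    case (single F p k)
    then obtain s t where F: "F = {s, t}" "s < t" by (auto simp: card_2_iff) (metis insert_commute neqE)
    have p: "p \<in> M" using single by simp
    then have "((s, p + unit_expo t), (t, p + unit_expo s)) \<in> koszul_edge M"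
      "((t, p + unit_expo s), (s, p + unit_expo t)) \<in> koszul_edge M"
      using F(2) by (auto simp: koszul_edge_def)
    \<comment> \<open>Both terms of the boundary lie in \<open>C\<close> or neither does, so their
      coefficients \<open>k\<close> and \<open>-k\<close> cancel.\<close>
    then have "({t}, p + unit_expo s) \<in> C \<longleftrightarrow> ({s}, p + unit_expo t) \<in> C"
      unfolding C_def by (auto intro: rtrancl_into_rtrancl)
    then show ?case
      by (simp add: F(1) differential_koszul_doubleton[OF F(2)] coeff_sum_diff coeff_sum_single del: differential_single)
  qed simp
  \<comment> \<open>On the given difference the coefficient sum is therefore 1, not 0.\<close>
  moreover have "({v}, m) \<in> C" "({w}, m') \<notin> C" using no by (auto simp: C_def)
  ultimately show False
    unfolding d[symmetric] by (simp add: coeff_sum_diff coeff_sum_single)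
qed

text \<open>Modulo boundaries each term \<open>x\<^sup>m e\<^sub>v\<close> may be moved to a term chosen in dependence on its multidegree
  only, and the resulting chain is a function of the differential alone.\<close>

lemma boundary_if_koszul_connected:
  fixes z :: "'n::{finite,linorder} set \<Rightarrow>\<^sub>0 ('n, 'k::field) mpoly"
  assumes z: "z \<in> cycles koszul (exponent_ideal M) 1"
    and conn: "\<And>v m. m \<in> keys (lookup z {v}) \<Longrightarrow> koszul_connected M (m + unit_expo v)"
  shows "z \<in> boundaries koszul (exponent_ideal M) 1"
proof -
  \<comment> \<open>The choice is meaningful only in multidegrees that have a vertex; every term of
    \<open>z\<close> lies in such a multidegree.\<close>
  define root where "root a = (SOME (w, m). m \<in> M \<and> m + unit_expo w = a)" for a :: "'n expo"
  define rep where "rep a k = (case root a of (w, m) \<Rightarrow> Poly_Mapping.single {w} (Poly_Mapping.single m k))"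
    for a and k :: 'k
  define \<rho> where "\<rho> f = (\<Sum>a\<in>keys f. rep a (lookup f a))" for f
  have rep_0: "rep a 0 = 0" for a by (simp add: rep_def split: prod.split)
  have rep_add: "rep a (k + l) = rep a k + rep a l" for a k l
    by (simp add: rep_def single_add split: prod.split)
  have \<rho>_add: "\<rho> (f + g) = \<rho> f + \<rho> g" for f g
    unfolding \<rho>_def by (rule setsum_keys_plus_distrib) (simp_all add: rep_0 rep_add)
  have \<rho>_single: "\<rho> (Poly_Mapping.single a k) = rep a k" for a k
    by (cases "k = 0") (simp_all add: \<rho>_def rep_0)
  \<comment> \<open>Connectivity is recorded for each term, so that it is available for single terms
    in the induction.\<close>
  have "{(F, m). m \<in> keys (lookup z F)} \<subseteq> {({v}, m) | v m. m \<in> M \<and> koszul_connected M (m + unit_expo v)}"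
  proof clarify
    fix F m assume m: "m \<in> keys (lookup z F)"
    have "F \<in> keys z" using m by (metis in_keys_iff keys_zero empty_iff)
    then have "card F = 1" using z by (auto simp: cycles_def tensor_chains_def)
    then obtain v where "F = {v}" by (auto simp: card_1_singleton_iff)
    moreover have "m \<in> M" using z m by (auto simp: cycles_def tensor_chains_def exponent_ideal_def)
    ultimately show "\<exists>v m'. (F, m) = ({v}, m') \<and> m' \<in> M \<and> koszul_connected M (m' + unit_expo v)"
      using conn m by blast
  qed
  then have "z - \<rho> (lookup (differential koszul z) {}) \<in> boundaries koszul (exponent_ideal M) 1"
  proof (induction rule: chain_induct_terms)
    case zero
    show ?case by (simp add: \<rho>_def)
  next
    case (add c c')
    from boundaries_add[OF this] show ?case
      by (simp add: differential_add lookup_add \<rho>_add algebra_simps)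
  next
    case (single F m k)
    then obtain v where v: "F = {v}" "m \<in> M" and cn: "koszul_connected M (m + unit_expo v)" by auto
    obtain w m' where w: "root (m + unit_expo v) = (w, m')" by (cases "root (m + unit_expo v)")
    have "(\<lambda>(w, n). n \<in> M \<and> n + unit_expo w = m + unit_expo v) (root (m + unit_expo v))"
      unfolding root_def by (rule someI[of _ "(v, m)"]) (simp add: v)
    with w have "m' \<in> M" "m' + unit_expo w = m + unit_expo v" by auto
    with cn v(2) have "((v, m), (w, m')) \<in> (koszul_edge M)\<^sup>*"
      by (simp add: koszul_connected_def)
    from boundary_koszul_edge[OF this, of k] show ?case
      by (simp add: v(1) differential_koszul_singleton \<rho>_single rep_def w del: differential_single)
  qed
  moreover have "differential koszul z = 0" using z by (simp add: cycles_def)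
  ultimately show ?thesis by (simp add: \<rho>_def)
qed

text \<open>Both terms have the same differential x^a. These two-term cycles detect
  disconnectedness.\<close>

lemma cycle_koszul_difference:
  fixes M :: "'n::{finite,linorder} expo set"
  assumes "m \<in> M" "m' \<in> M" "m + unit_expo v = a" "m' + unit_expo w = a"
  defines "z \<equiv> Poly_Mapping.single {v} (Poly_Mapping.single m (1 :: 'k::field)) -
    Poly_Mapping.single {w} (Poly_Mapping.single m' 1)"
  shows "z \<in> cycles koszul (exponent_ideal M) 1" "multihomogeneous koszul a z"
proof -
  have "lookup z F \<in> exponent_ideal M \<and> (\<forall>n\<in>keys (lookup z F). n + bdeg koszul F = a)" for F
  proof -
    have "keys (lookup z F) \<subseteq> {n. n \<in> {m, m'} \<and> n + bdeg koszul F = a}"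
      unfolding z_def using assms(3,4)
      by (auto simp: lookup_minus lookup_single when_def bdeg_koszul_singleton in_keys_iff
          simp del: koszul_simps split: if_splits)
    then show ?thesis using assms(1,2) by (auto simp: exponent_ideal_def)
  qed
  moreover have "keys z \<subseteq> basis koszul 1"
    by (auto simp: z_def in_keys_iff lookup_minus lookup_single when_def split: if_splits)
  moreover have "differential koszul z = 0"
    unfolding z_def differential_diff differential_koszul_singleton assms(3,4) by simp
  ultimately show "z \<in> cycles koszul (exponent_ideal M) 1" "multihomogeneous koszul a z"
    unfolding cycles_def tensor_chains_def multihomogeneous_def by blast+
qed

section \<open>First Tor in terms of connectivity\<close>

lemma multihomogeneous_imp_total_homogeneous:
  "multihomogeneous P a z \<Longrightarrow> total_homogeneous P (total_degree a) z"
  by (auto simp: multihomogeneous_def total_homogeneous_def)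

text \<open>Vanishing is tested on two-term cycles. Conversely,
  \<open>boundary_if_koszul_connected\<close> treats all multidegrees of a cycle at once, so no
  splitting into multihomogeneous parts is made.\<close>

lemma Tor_degree_trivial_iff_koszul_connected:
  fixes M :: "'n::{finite,linorder} expo set"
  shows "Tor_degree 1 (exponent_ideal M :: ('n, 'k::field) mpoly set) j =
      {boundaries koszul (exponent_ideal M) 1} \<longleftrightarrow>
    (\<forall>a::'n expo. total_degree a = j \<longrightarrow> koszul_connected M a)"
proof -
  let ?J = "exponent_ideal M :: ('n, 'k) mpoly set"
  have "(\<forall>z\<in>cycles koszul ?J 1. total_homogeneous koszul j z \<longrightarrow> z \<in> boundaries koszul ?J 1) \<longleftrightarrow>
    (\<forall>a::'n expo. total_degree a = j \<longrightarrow> koszul_connected M a)"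
  proof (intro iffI allI impI ballI)
    fix a :: "'n expo" assume tor: "\<forall>z\<in>cycles koszul ?J 1. total_homogeneous koszul j z \<longrightarrow> z \<in> boundaries koszul ?J 1"
      and a: "total_degree a = j"
    show "koszul_connected M a"
      unfolding koszul_connected_def
    proof (intro allI impI)
      fix v m w m' assume m: "m \<in> M" "m' \<in> M" "m + unit_expo v = a" "m' + unit_expo w = a"
      show "((v, m), (w, m')) \<in> (koszul_edge M)\<^sup>*"
        using tor cycle_koszul_difference[OF m, where 'k = 'k] multihomogeneous_imp_total_homogeneous
          koszul_edge_if_boundary[where 'k = 'k] a by metis
    qed
  next
    fix z assume conn: "\<forall>a::'n expo. total_degree a = j \<longrightarrow> koszul_connected M a"
      and z: "z \<in> cycles koszul ?J 1" "total_homogeneous koszul j z"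
    have "total_degree (m + unit_expo v) = j" if "m \<in> keys (lookup z {v})" for v m
      using z(2) that unfolding total_homogeneous_def by (metis bdeg_koszul_singleton)
    then show "z \<in> boundaries koszul ?J 1" using conn z by (intro boundary_if_koszul_connected) auto
  qed
  then show ?thesis
    unfolding Tor_degree_def by (subst homology_component_trivial_iff) (auto simp: total_homogeneous_def)
qed

text \<open>Outside degree \<open>d + 1\<close> connectivity makes Tor vanish. In degree
  \<open>d + 1\<close> the vertices come from \<open>G\<close> itself and there are no edges, so Tor
  is nonzero iff there are two distinct vertices.\<close>

lemma Tor_multidegree_support:
  fixes G :: "'n::{finite,linorder} expo set"
  assumes deg: "\<And>u. u \<in> G \<Longrightarrow> total_degree u = d"
    and conn: "\<And>b. total_degree b \<noteq> d + 1 \<Longrightarrow> koszul_connected (up_closure G) b"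
  defines "J \<equiv> exponent_ideal (up_closure G) :: ('n, 'k::field) mpoly set"
  shows "{a. Tor_multidegree 1 J a \<noteq> {boundaries koszul J 1}} = swap_lcms G"
proof -
  have low: "m \<in> G" if "m \<in> up_closure G" "total_degree m = d" for m
    using that deg expo_le_antisym_degree by (fastforce simp: up_closure_def)
  have nontrivial: "Tor_multidegree 1 J a \<noteq> {boundaries koszul J 1} \<longleftrightarrow>
    (\<exists>z\<in>cycles koszul J 1. multihomogeneous koszul a z \<and> z \<notin> boundaries koszul J 1)" for a
    unfolding Tor_multidegree_def J_def
    by (subst homology_component_trivial_iff) (auto simp: multihomogeneous_def)
  show ?thesis
  proof (intro subset_antisym subsetI; unfold mem_Collect_eq nontrivial)
    fix a assume "\<exists>z\<in>cycles koszul J 1. multihomogeneous koszul a z \<and> z \<notin> boundaries koszul J 1"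
    then obtain z where z: "z \<in> cycles koszul J 1" "multihomogeneous koszul a z" "z \<notin> boundaries koszul J 1"
      by blast
    have "m + unit_expo v = a" if "m \<in> keys (lookup z {v})" for v m
      using z(2) that unfolding multihomogeneous_def by (metis bdeg_koszul_singleton)
    with z(1,3) have nc: "\<not> koszul_connected (up_closure G) a"
      using boundary_if_koszul_connected unfolding J_def by metis
    with conn have a: "total_degree a = d + 1" by blast
    obtain v m w m' where m: "m \<in> up_closure G" "m' \<in> up_closure G" "m + unit_expo v = a" "m' + unit_expo w = a"
      and ne: "((v, m), (w, m')) \<notin> (koszul_edge (up_closure G))\<^sup>*"
      using nc unfolding koszul_connected_def by blast
    have "v \<noteq> w" using m ne by auto
    moreover have "total_degree m = d" "total_degree m' = d"
      using a arg_cong[OF m(3), of total_degree] arg_cong[OF m(4), of total_degree] by simp_all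
    then have "m \<in> G" "m' \<in> G" using low m(1,2) by blast+
    ultimately show "a \<in> swap_lcms G"
      using m(3,4) unfolding swap_lcms_def
      by (intro CollectI bexI[of _ m] bexI[of _ m'] exI[of _ v] exI[of _ w]) auto
  next
    fix a assume "a \<in> swap_lcms G"
    then obtain v m w m' where m: "m \<in> G" "m' \<in> G" "v \<noteq> w" "m + unit_expo v = a" "m' + unit_expo w = a"
      by (auto simp: swap_lcms_def)
    have "((v, m), (w, m')) \<notin> (koszul_edge (up_closure G))\<^sup>*"
    proof
      assume "((v, m), (w, m')) \<in> (koszul_edge (up_closure G))\<^sup>*"
      \<comment> \<open>A path between distinct vertices begins with an edge, which puts
        \<open>p\<close> of degree \<open>d - 1\<close> into the ideal, below the degree of all
        generators.\<close>
      then obtain x p where p: "p \<in> up_closure G" "m = p + unit_expo x"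
      proof (cases rule: converse_rtranclE)
        case base
        with m(3) show ?thesis by simp
      next
        case (step y)
        with that show ?thesis by (auto simp: koszul_edge_def)
      qed
      then obtain u where "u \<in> G" "expo_le u p" by (auto simp: up_closure_def)
      then have "d \<le> total_degree p" using deg total_degree_mono by blast
      with p(2) deg[OF m(1)] show False by simp
    qed
    then have "Poly_Mapping.single {v} (Poly_Mapping.single m (1 :: 'k)) -
        Poly_Mapping.single {w} (Poly_Mapping.single m' 1) \<notin> boundaries koszul J 1"
      unfolding J_def using koszul_edge_if_boundary by blast
    then show "\<exists>z\<in>cycles koszul J 1. multihomogeneous koszul a z \<and> z \<notin> boundaries koszul J 1"
      using cycle_koszul_difference[OF up_closure_base[OF m(1)] up_closure_base[OF m(2)] m(4,5), where 'k = 'k]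
      unfolding J_def by blast
  qed
qed

section \<open>Linear relatedness of monomial ideals\<close>

lemma linearly_related_exponent_ideal:
  assumes "\<And>u. u \<in> G \<Longrightarrow> total_degree u = d" "swap_connected G"
  shows "linearly_related (exponent_ideal (up_closure G) :: ('n::{finite,linorder}, 'k::field) mpoly set)"
  unfolding linearly_related_def Tor_degree_trivial_iff_koszul_connected
\<comment> \<open>This alternative also covers the zero ideal, where \<open>G\<close> is
  empty.\<close>
proof (intro disjI2 exI[of _ d] conjI allI impI)
  show "generated_in_degree d (exponent_ideal (up_closure G) :: ('n, 'k) mpoly set)"
    using assms(1) by (rule generated_in_degree_exponent_ideal)
  show "koszul_connected (up_closure G) a" if "j \<noteq> d + 1" "total_degree a = j" for j a
    using koszul_connected_if_swap_connected[OF assms] that by blast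
qed

lemma linearly_related_monomial_cases:
  assumes "monomial_ideal (I :: ('n::{finite,linorder}, 'k::field) mpoly set)" "linearly_related I"
  obtains G d where "I = exponent_ideal (up_closure G)" "\<And>u. u \<in> G \<Longrightarrow> total_degree u = d"
    "\<And>b. total_degree b \<noteq> d + 1 \<Longrightarrow> koszul_connected (up_closure G) b"
  using assms(2) unfolding linearly_related_def
proof (elim disjE exE conjE)
  assume "I = {0}"
  then have "I = exponent_ideal (up_closure {})" by (simp add: exponent_ideal_def up_closure_def)
  \<comment> \<open>With no generators the degree is arbitrary and no multidegree has a
    vertex.\<close>
  then show thesis by (rule that) (auto simp: koszul_connected_def up_closure_def)
next
  fix d assume gen: "generated_in_degree d I"
    and tor: "\<forall>j. j \<noteq> d + 1 \<longrightarrow> Tor_degree 1 I j = {boundaries koszul I 1}"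
  obtain A where "I = exponent_ideal (up_closure A)"
    using assms(1) by (auto simp: monomial_ideal_def ideal_span_monom)
  from exponent_ideal_generated_in_degree[OF this gen]
  have I: "I = exponent_ideal (up_closure {m \<in> up_closure A. total_degree m = d})" .
  show thesis
    using I tor[unfolded I Tor_degree_trivial_iff_koszul_connected]
    by (intro that[of "{m \<in> up_closure A. total_degree m = d}" d]) auto
qed

theorem theorem3p8:
  fixes I :: "('n::{finite,linorder}, 'k::field) mpoly set"
    and d :: nat
  assumes "monomial_ideal I"
    and "generated_in_degree d I"
    and "linearly_related I"
  shows "linearly_related (HS 1 I)"
proof -
  obtain G e where I: "I = exponent_ideal (up_closure G)"
    and deg: "\<And>u. u \<in> G \<Longrightarrow> total_degree u = e"
    and conn: "\<And>b. total_degree b \<noteq> e + 1 \<Longrightarrow> koszul_connected (up_closure G) b"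
    by (rule linearly_related_monomial_cases[OF assms(1,3)]) blast
  have support: "{a. Tor_multidegree 1 I a \<noteq> {boundaries koszul I 1}} = swap_lcms G"
    unfolding I by (rule Tor_multidegree_support[OF deg conn])
  have "HS 1 I = exponent_ideal (up_closure (swap_lcms G))"
    unfolding HS_def support by (rule ideal_span_monom)
  \<comment> \<open>The generating degree rises by one, so the linear relations of
    \<open>HS 1 I\<close> sit in degree \<open>e + 2\<close>.\<close>
  moreover have "total_degree a = e + 1" if "a \<in> swap_lcms G" for a
    using that deg by (auto simp: swap_lcms_def)
  ultimately show ?thesis
    using linearly_related_exponent_ideal[of "swap_lcms G" "e + 1"]
      swap_connected_swap_lcms[OF swap_connected_if_koszul_connected[OF deg conn]] by metis
qed

end
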